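(* Let $\Sigma$ be a relational schema, $q$ a Boolean conjunctive query over $\Sigma$ (with at least one atom), and $D$ a database over $\Sigma$. If $D \models_\Sigma q$, then there is a bunch $B$ of the conflict-join hypergraph $H_D$ of $D$ (w.r.t. $q$ and $\Sigma$) such that $B \models_\Sigma q$.
   Context: Fix disjoint countably infinite sets $\mathbf{C}$ (constants) and $\mathbf{V}$ (variables). A relational schema is a triple $\Sigma=\langle \mathcal{R},\alpha,\kappa\rangle$ with $\mathcal{R}$ a finite set of relation symbols, $\alpha:\mathcal{R}\to\mathbb{N}$ giving arities, and $\kappa$ assigning to each $r\in\mathcal{R}$ a nonempty set $\kappa(r)\subseteq\{1,\ldots,\alpha(r)\}$ (the primary key positions). An atom is $r(t_1,\ldots,t_{\alpha(r)})$ with terms $t_i\in\mathbf{C}\cup\mathbf{V}$; it is a fact if all terms are constants. A database is a finite set of facts. For an atom $r(\mathbf{t})$, $\hat{\mathbf{t}}$ is the subsequence of $\mathbf{t}$ at the positions in $\kappa(r)$. A database is inconsistent if it contains two different facts $r(\mathbf{t}_1),r(\mathbf{t}_2)$ with $\hat{\mathbf{t}}_1=\hat{\mathbf{t}}_2$; otherwise it is consistent. A repair of $D$ is a maximal (w.r.t. inclusion) consistent subset of $D$. A substitution is a map $\mu:\mathbf{C}\cup\mathbf{V}\to\mathbf{C}\cup\mathbf{V}$ that is the identity on $\mathbf{C}$, extended to (sets of) atoms termwise. A Boolean conjunctive query (BCQ) $q$ is an existentially closed conjunction of atoms (possibly with constants), identified with the set of its atoms. $q$ is true in a database $R$ if $\mu(q)\subseteq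 R$ for some substitution $\mu$. $D\models_\Sigma q$ ("$q$ is consistently true in $D$") means that $q$ is true in every repair of $D$. A key component of $D$ is a maximal subset $K\subseteq D$ such that any two facts $r_1(\mathbf{t}_1),r_2(\mathbf{t}_2)\in K$ satisfy $r_1=r_2$ and $\hat{\mathbf{t}}_1=\hat{\mathbf{t}}_2$; the set of all key components of $D$ is denoted $\mathit{comp}(D,\Sigma)$. Let $\mathit{var}(q)$ be the set of variables of $q$ and $\mathit{sub}(q,D)=\{\mu|_{\mathit{var}(q)} : \mu \text{ is a substitution and } \mu(q)\subseteq D\}$. The conflict-join hypergraph of $D$ (w.r.t. $q$ and $\Sigma$) is $H_D=\langle D,E\rangle$, with vertex set $D$ and hyperedge set $E=E_q\cup E_\kappa$, where $E_q=\{\mu(q):\mu\in\mathit{sub}(q,D)\}$ and $E_\kappa=\mathit{comp}(D,\Sigma)$. A bunch of $H_D$ is any (inclusion-)minimal nonempty subset $B\subseteq D$ such that, for each $e\in E$, either $e\subseteq B$ or $e\cap B=\emptyset$. *)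

theory Defs
  imports "HOL-Library.Countable" "HOL-Library.Infinite_Typeclass"
begin

record 'r schema =
  rels :: "'r set"
  arity :: "'r \<Rightarrow> nat"
  key :: "'r \<Rightarrow> nat set"

definition schema :: "'r schema \<Rightarrow> bool" where
  "schema \<Sigma> \<longleftrightarrow>
     finite (rels \<Sigma>) \<and> (\<forall>r\<in>rels \<Sigma>. key \<Sigma> r \<noteq> {} \<and> key \<Sigma> r \<subseteq> {1..arity \<Sigma> r})"

datatype ('c, 'v) trm = Const 'c | Var 'v

datatype ('r, 'c, 'v) atom = Atom (rel: 'r) (args: "('c, 'v) trm list")

definition atom_over :: "'r schema \<Rightarrow> ('r, 'c, 'v) atom \<Rightarrow> bool" where
  "atom_over \<Sigma> a \<longleftrightarrow> rel a \<in> rels \<Sigma> \<and> length (args a) = arity \<Sigma> (rel a)"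

definition fact :: "('r, 'c, 'v) atom \<Rightarrow> bool" where
  "fact a \<longleftrightarrow> set (args a) \<subseteq> range Const"

definition database :: "'r schema \<Rightarrow> ('r, 'c, 'v) atom set \<Rightarrow> bool" where
  "database \<Sigma> D \<longleftrightarrow> finite D \<and> (\<forall>a\<in>D. atom_over \<Sigma> a \<and> fact a)"

text \<open>Key positions count from 1, whereas list positions count from 0.\<close>

definition key_args :: "'r schema \<Rightarrow> ('r, 'c, 'v) atom \<Rightarrow> ('c, 'v) trm list" where
  "key_args \<Sigma> a = nths (args a) {i. Suc i \<in> key \<Sigma> (rel a)}"

definition consistent :: "'r schema \<Rightarrow> ('r, 'c, 'v) atom set \<Rightarrow> bool" where
  "consistent \<Sigma> D \<longleftrightarrow>
     \<not> (\<exists>a\<in>D. \<exists>b\<in>D. a \<noteq> b \<and> rel a = rel b \<and> key_args \<Sigma> a = key_args \<Sigma> b)"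

definition repair :: "'r schema \<Rightarrow> ('r, 'c, 'v) atom set \<Rightarrow> ('r, 'c, 'v) atom set \<Rightarrow> bool" where
  "repair \<Sigma> D R \<longleftrightarrow>
     R \<subseteq> D \<and> consistent \<Sigma> R \<and> (\<forall>S. R \<subseteq> S \<and> S \<subseteq> D \<and> consistent \<Sigma> S \<longrightarrow> S = R)"

definition substitution :: "(('c, 'v) trm \<Rightarrow> ('c, 'v) trm) \<Rightarrow> bool" where
  "substitution \<mu> \<longleftrightarrow> (\<forall>c. \<mu> (Const c) = Const c)"

definition subst_atom ::
    "(('c, 'v) trm \<Rightarrow> ('c, 'v) trm) \<Rightarrow> ('r, 'c, 'v) atom \<Rightarrow> ('r, 'c, 'v) atom" where
  "subst_atom \<mu> a = Atom (rel a) (map \<mu> (args a))"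

definition bcq :: "'r schema \<Rightarrow> ('r, 'c, 'v) atom set \<Rightarrow> bool" where
  "bcq \<Sigma> q \<longleftrightarrow> finite q \<and> (\<forall>a\<in>q. atom_over \<Sigma> a)"

definition true_in :: "('r, 'c, 'v) atom set \<Rightarrow> ('r, 'c, 'v) atom set \<Rightarrow> bool" where
  "true_in R q \<longleftrightarrow> (\<exists>\<mu>. substitution \<mu> \<and> subst_atom \<mu> ` q \<subseteq> R)"

definition consistently_true ::
    "'r schema \<Rightarrow> ('r, 'c, 'v) atom set \<Rightarrow> ('r, 'c, 'v) atom set \<Rightarrow> bool" where
  "consistently_true \<Sigma> D q \<longleftrightarrow> (\<forall>R. repair \<Sigma> D R \<longrightarrow> true_in R q)"

definition same_key_set :: "'r schema \<Rightarrow> ('r, 'c, 'v) atom set \<Rightarrow> bool" where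
  "same_key_set \<Sigma> K \<longleftrightarrow>
     (\<forall>a\<in>K. \<forall>b\<in>K. rel a = rel b \<and> key_args \<Sigma> a = key_args \<Sigma> b)"

definition key_components :: "'r schema \<Rightarrow> ('r, 'c, 'v) atom set \<Rightarrow> ('r, 'c, 'v) atom set set" where
  "key_components \<Sigma> D =
     {K. K \<subseteq> D \<and> same_key_set \<Sigma> K \<and>
         (\<forall>L. K \<subseteq> L \<and> L \<subseteq> D \<and> same_key_set \<Sigma> L \<longrightarrow> L = K)}"

definition vars :: "('r, 'c, 'v) atom set \<Rightarrow> 'v set" where
  "vars q = {v. \<exists>a\<in>q. Var v \<in> set (args a)}"

text \<open>
  The restriction of a substitution to a set of variables is represented by the substitution
  that agrees with it on this set and is the identity elsewhere, so that it can be applied to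
  queries containing constants.
\<close>

definition restrict_subst ::
    "(('c, 'v) trm \<Rightarrow> ('c, 'v) trm) \<Rightarrow> 'v set \<Rightarrow> (('c, 'v) trm \<Rightarrow> ('c, 'v) trm)" where
  "restrict_subst \<mu> X = (\<lambda>t. if t \<in> Var ` X then \<mu> t else t)"

definition sub ::
    "('r, 'c, 'v) atom set \<Rightarrow> ('r, 'c, 'v) atom set \<Rightarrow> (('c, 'v) trm \<Rightarrow> ('c, 'v) trm) set" where
  "sub q D = {restrict_subst \<mu> (vars q) | \<mu>. substitution \<mu> \<and> subst_atom \<mu> ` q \<subseteq> D}"

text \<open>A hypergraph is the pair of its vertex set and its set of hyperedges.\<close>

type_synonym 'a hypergraph = "'a set \<times> 'a set set"

definition conflict_join_hypergraph ::
    "'r schema \<Rightarrow> ('r, 'c, 'v) atom set \<Rightarrow> ('r, 'c, 'v) atom set \<Rightarrow>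
     ('r, 'c, 'v) atom hypergraph" where
  "conflict_join_hypergraph \<Sigma> q D = (D, {subst_atom \<mu> ` q | \<mu>. \<mu> \<in> sub q D} \<union> key_components \<Sigma> D)"

definition edge_closed :: "'a hypergraph \<Rightarrow> 'a set \<Rightarrow> bool" where
  "edge_closed H B \<longleftrightarrow> (\<forall>e\<in>snd H. e \<subseteq> B \<or> e \<inter> B = {})"

definition bunch :: "'a hypergraph \<Rightarrow> 'a set \<Rightarrow> bool" where
  "bunch H B \<longleftrightarrow>
     B \<noteq> {} \<and> B \<subseteq> fst H \<and> edge_closed H B \<and>
     (\<forall>C. C \<noteq> {} \<and> C \<subseteq> B \<and> edge_closed H C \<longrightarrow> C = B)"

end

(* The bunches partition the facts, and key components never cross a bunch, so choosing one repair
   in each bunch and taking the union gives a repair of the whole database. If every bunch had a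
   repair falsifying the query, the union would satisfy it through an edge of the hypergraph; this
   nonempty edge lies in a single bunch, hence in a single chosen repair, a contradiction. *)

theory Submission
  imports Defs
begin

lemma edge_closed_Int:
  assumes "edge_closed H B" and "edge_closed H C"
  shows "edge_closed H (B \<inter> C)"
  using assms unfolding edge_closed_def by blast

lemma edge_closed_Diff:
  assumes "edge_closed H B" and "edge_closed H C"
  shows "edge_closed H (B - C)"
  using assms unfolding edge_closed_def by blast

text \<open>If some member of \<open>F\<close> misses an edge, so does the intersection; otherwise
  every member contains that edge.\<close>

lemma edge_closed_Inter:
  assumes "\<And>B. B \<in> F \<Longrightarrow> edge_closed H B"
  shows "edge_closed H (\<Inter>F)"
  using assms unfolding edge_closed_def by blast

text \<open>The intersection is again edge-closed, and nonempty because of \<open>x\<close>, so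
  minimality of each bunch forces it to equal both.\<close>

lemma bunch_eq:
  assumes "bunch H B" and "bunch H C" and "x \<in> B" and "x \<in> C"
  shows "B = C"
proof -
  have "edge_closed H (B \<inter> C)"
    using assms(1,2) by (simp add: bunch_def edge_closed_Int)
  moreover have "B \<inter> C \<noteq> {}"
    using assms(3,4) by blast
  ultimately have "B \<inter> C = B" "B \<inter> C = C"
    using assms(1,2) unfolding bunch_def by auto
  then show ?thesis by simp
qed

text \<open>The bunch is the least edge-closed vertex set containing \<open>x\<close>; since edges
  consist of vertices, \<open>fst H\<close> is one of the sets intersected.\<close>

lemma ex_bunch:
  assumes edges: "\<And>e. e \<in> snd H \<Longrightarrow> e \<subseteq> fst H" and x: "x \<in> fst H"
  obtains B where "bunch H B" and "x \<in> B"
proof -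
  define M where "M = \<Inter>{C. x \<in> C \<and> C \<subseteq> fst H \<and> edge_closed H C}"
  have least: "M \<subseteq> C" if "x \<in> C" "C \<subseteq> fst H" "edge_closed H C" for C
    using that unfolding M_def by blast
  have closed: "edge_closed H M"
    unfolding M_def by (rule edge_closed_Inter) simp
  have xM: "x \<in> M"
    unfolding M_def by blast
  have "edge_closed H (fst H)"
    using edges unfolding edge_closed_def by blast
  then have sub: "M \<subseteq> fst H"
    using least x by blast
  have "C = M" if C: "C \<noteq> {}" "C \<subseteq> M" "edge_closed H C" for C
  proof (cases "x \<in> C")
    case True
    then show ?thesis using least C sub by blast
  next
    case False
    \<comment> \<open>Removing \<open>C\<close> keeps \<open>x\<close> and edge-closedness, so
      leastness of \<open>M\<close> makes \<open>C\<close> disjoint from \<open>M\<close>,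
      contradicting that it is a nonempty subset.\<close>
    have "M \<subseteq> M - C"
      by (rule least) (use False xM sub edge_closed_Diff[OF closed C(3)] in auto)
    then show ?thesis using C by blast
  qed
  then have "bunch H M"
    using xM sub closed unfolding bunch_def by blast
  then show ?thesis using that xM by blast
qed

text \<open>Both maps fix constants and agree on the variables of \<open>q\<close>. This links truth
  of \<open>q\<close>, stated with arbitrary substitutions, to hyperedges, built from restricted
  ones.\<close>

lemma subst_atom_restrict_subst_image:
  assumes "substitution \<mu>"
  shows "subst_atom (restrict_subst \<mu> (vars q)) ` q = subst_atom \<mu> ` q"
proof (rule image_cong[OF refl])
  fix a assume "a \<in> q"
  then have "restrict_subst \<mu> (vars q) t = \<mu> t" if "t \<in> set (args a)" for t
    using that assms by (cases t) (auto simp: restrict_subst_def vars_def substitution_def)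
  then show "subst_atom (restrict_subst \<mu> (vars q)) a = subst_atom \<mu> a"
    by (simp add: subst_atom_def)
qed

lemma subst_atom_image_edge:
  assumes "substitution \<mu>" and "subst_atom \<mu> ` q \<subseteq> D"
  shows "subst_atom \<mu> ` q \<in> snd (conflict_join_hypergraph \<Sigma> q D)"
proof -
  have "restrict_subst \<mu> (vars q) \<in> sub q D"
    using assms unfolding sub_def by blast
  then show ?thesis
    using subst_atom_restrict_subst_image[OF assms(1), of q]
    unfolding conflict_join_hypergraph_def by fastforce
qed

lemma conflict_join_edge_subset:
  assumes "e \<in> snd (conflict_join_hypergraph \<Sigma> q D)"
  shows "e \<subseteq> D"
proof -
  have "subst_atom \<nu> ` q \<subseteq> D" if "\<nu> \<in> sub q D" for \<nu>
  proof -
    obtain \<mu> where "\<nu> = restrict_subst \<mu> (vars q)" "substitution \<mu>" "subst_atom \<mu> ` q \<subseteq> D"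
      using \<open>\<nu> \<in> sub q D\<close> unfolding sub_def by blast
    then show ?thesis
      by (simp only: subst_atom_restrict_subst_image)
  qed
  then show ?thesis
    using assms unfolding conflict_join_hypergraph_def key_components_def by auto
qed

text \<open>Any same-key set extending this class contains \<open>a\<close>, so all its members
  share the key of \<open>a\<close>; hence the class is maximal.\<close>

lemma key_component_edge:
  assumes "a \<in> D"
  shows "{b \<in> D. rel b = rel a \<and> key_args \<Sigma> b = key_args \<Sigma> a}
    \<in> snd (conflict_join_hypergraph \<Sigma> q D)"
    (is "?K \<in> _")
proof -
  have "same_key_set \<Sigma> ?K"
    by (simp add: same_key_set_def)
  moreover have "L = ?K" if "?K \<subseteq> L" "L \<subseteq> D" "same_key_set \<Sigma> L" for L
  proof -
    have "a \<in> L"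
      using that(1) assms by blast
    then have "L \<subseteq> ?K"
      using that(2,3) unfolding same_key_set_def by blast
    then show ?thesis
      using that(1) by blast
  qed
  moreover have "?K \<subseteq> D"
    by blast
  ultimately have "?K \<in> key_components \<Sigma> D"
    unfolding key_components_def by blast
  then show ?thesis
    by (simp only: conflict_join_hypergraph_def snd_conv UnI2)
qed

theorem theorem1:
  fixes \<Sigma> :: "'r schema"
    and q D :: "('r, 'c::{countable,infinite}, 'v::{countable,infinite}) atom set"
  assumes "schema \<Sigma>"
    and "bcq \<Sigma> q"
    and "q \<noteq> {}"
    and "database \<Sigma> D"
    and "consistently_true \<Sigma> D q"
  shows "\<exists>B. bunch (conflict_join_hypergraph \<Sigma> q D) B \<and> consistently_true \<Sigma> B q"
proof (rule ccontr)
  define H where "H = conflict_join_hypergraph \<Sigma> q D"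
  assume "\<not> ?thesis"
  then have "\<forall>B. \<exists>R. bunch H B \<longrightarrow> repair \<Sigma> B R \<and> \<not> true_in R q"
    unfolding H_def consistently_true_def by blast
  then obtain rep where rep: "\<And>B. bunch H B \<Longrightarrow> repair \<Sigma> B (rep B)"
    and false: "\<And>B. bunch H B \<Longrightarrow> \<not> true_in (rep B) q"
    by metis
  have fst_H: "fst H = D"
    by (simp add: H_def conflict_join_hypergraph_def)
  have bunch_subset: "B \<subseteq> D" if "bunch H B" for B
    using that fst_H unfolding bunch_def by blast
  have cover: "\<exists>B. bunch H B \<and> a \<in> B" if "a \<in> D" for a
    using ex_bunch[of H a] conflict_join_edge_subset that fst_H unfolding H_def by metis
  have edge: "e \<subseteq> B" if "bunch H B" "e \<in> snd H" "a \<in> e" "a \<in> B" for e a B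
    using that unfolding bunch_def edge_closed_def by blast
  have rep_subset: "rep B \<subseteq> B" if "bunch H B" for B
    using rep[OF that] unfolding repair_def by blast
  define R where "R = (\<Union>B\<in>{B. bunch H B}. rep B)"
  \<comment> \<open>A fact of \<open>R\<close> in \<open>B\<close> was contributed by some bunch
    containing it; that bunch meets \<open>B\<close>, hence is \<open>B\<close>.\<close>
  have R_Int: "R \<inter> B \<subseteq> rep B" if "bunch H B" for B
    using bunch_eq[OF that] rep_subset unfolding R_def by blast
  have "R \<subseteq> D"
    using rep_subset bunch_subset unfolding R_def by blast
  have "a = b" if ab: "a \<in> R" "b \<in> R" "rel a = rel b" "key_args \<Sigma> a = key_args \<Sigma> b" for a b
  proof -
    obtain B where B: "bunch H B" "a \<in> rep B"
      using ab(1) unfolding R_def by blast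
    \<comment> \<open>This edge meets \<open>B\<close> in \<open>a\<close>, so a fact in conflict
      with \<open>a\<close> lies in the same bunch, and consistency of \<open>rep B\<close> excludes
      it.\<close>
    have "{c \<in> D. rel c = rel a \<and> key_args \<Sigma> c = key_args \<Sigma> a} \<subseteq> B"
      using edge[OF B(1), of _ a] key_component_edge[of a D \<Sigma> q] B rep_subset bunch_subset
      unfolding H_def by blast
    then have "b \<in> B"
      using ab(2) ab(3,4)[symmetric] \<open>R \<subseteq> D\<close> by blast
    then have "b \<in> rep B"
      using R_Int[OF B(1)] ab(2) by blast
    then show ?thesis
      using rep[OF B(1)] B(2) ab(3,4) unfolding repair_def consistent_def by blast
  qed
  then have "consistent \<Sigma> R"
    unfolding consistent_def by blast
  \<comment> \<open>Maximality is checked bunch by bunch: \<open>S \<inter> B\<close> is consistent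
    and extends \<open>rep B\<close>, so it equals \<open>rep B\<close>.\<close>
  moreover have "S \<subseteq> R" if S: "R \<subseteq> S" "S \<subseteq> D" "consistent \<Sigma> S" for S
  proof
    fix a assume "a \<in> S"
    then obtain B where B: "bunch H B" "a \<in> B"
      using cover S(2) by blast
    have "consistent \<Sigma> (S \<inter> B)"
      using S(3) unfolding consistent_def by blast
    moreover have "rep B \<subseteq> S \<inter> B"
      using B(1) S(1) rep_subset unfolding R_def by blast
    ultimately have "S \<inter> B = rep B"
      using rep[OF B(1)] unfolding repair_def by blast
    then show "a \<in> R"
      using \<open>a \<in> S\<close> B unfolding R_def by blast
  qed
  ultimately have "repair \<Sigma> D R"
    using \<open>R \<subseteq> D\<close> unfolding repair_def by blast
  then obtain \<mu> where \<mu>: "substitution \<mu>" "subst_atom \<mu> ` q \<subseteq> R"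
    using assms(5) unfolding consistently_true_def true_in_def by blast
  \<comment> \<open>One fact of the image singles out the bunch \<open>B\<close>; the image is an
    edge meeting \<open>B\<close>, so all of it follows.\<close>
  obtain a where a: "a \<in> subst_atom \<mu> ` q"
    using assms(3) by blast
  then obtain B where B: "bunch H B" "a \<in> B"
    using \<mu>(2) \<open>R \<subseteq> D\<close> cover by blast
  have "subst_atom \<mu> ` q \<subseteq> B"
    using edge[OF B(1) _ a B(2)] subst_atom_image_edge[OF \<mu>(1)] \<mu>(2) \<open>R \<subseteq> D\<close>
    unfolding H_def by blast
  then have "subst_atom \<mu> ` q \<subseteq> rep B"
    using \<mu>(2) R_Int[OF B(1)] by blast
  then show False
    using false[OF B(1)] \<mu>(1) unfolding true_in_def by blast
qed

end
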